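(* Let $m\ge l>k$ and $L\ge2$ be integers, and assume $L>2$ if $m<2l$. Let $E$ be an $m\times k$ random matrix with independent $\mathcal N(0,1)$ entries. Then for any $\eta$ with $0<\eta<1-\frac{1}{\lfloor m/l\rfloor(L-1)}$, $$\mathscr D_{\mathrm a}(E,L)<16e\,m^{3/2}l^{-1}L^{-(1-\eta)\lfloor m/l\rfloor}$$ with probability at least $$1-e^{l/2}\Big(10+8\sqrt{\eta\lfloor m/l\rfloor\log L}\Big)^k e^{\frac{\eta}{1-\eta}(l-k)}L^{-\eta\lfloor m/l\rfloor(l-k)}-e^{-2m}.$$
   Context: For a $k\times m$ matrix $F$, finite $\mathscr A\subset\mathbb{R}$ and bounded $\mathscr X\subset\mathbb{R}^k$, $\mathscr D_{\mathrm s}(F,\mathscr A,\mathscr X):=\sup_{x\in\mathscr X}\inf_{q\in\mathscr A^m}\|x-Fq\|_2$; for an $m\times k$ matrix $E$, $\mathscr D_{\mathrm a}(E,\mathscr A,\mathscr X):=\inf\{\mathscr D_{\mathrm s}(F,\mathscr A,\mathscr X):FE=I_k\}$ (infimum over empty set is $+\infty$); and $\mathscr D_{\mathrm a}(E,L):=\inf_{|\mathscr A|=L}\mathscr D_{\mathrm a}(E,\mathscr A,B_1)$ with $B_1$ the closed unit Euclidean ball of $\mathbb{R}^k$. *)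

theory Defs
  imports "HOL-Probability.Probability"
begin

definition alph_vecs :: "real set \<Rightarrow> (real ^ 'm) set" where
  "alph_vecs A = {q. \<forall>i. q $ i \<in> A}"

definition D_s :: "real ^ 'm ^ 'k \<Rightarrow> real set \<Rightarrow> (real ^ 'k) set \<Rightarrow> ereal" where
  "D_s F A X = (SUP x\<in>X. INF q\<in>alph_vecs A. ereal (norm (x - F *v q)))"

text \<open>D_a(E,A,X) = inf of D_s(F,A,X) over left inverses F of E (E is m x k);
  infimum over the empty set is +infinity.\<close>
definition D_a :: "real ^ 'k ^ 'm \<Rightarrow> real set \<Rightarrow> (real ^ 'k) set \<Rightarrow> ereal" where
  "D_a E A X = (INF F\<in>{F :: real ^ 'm ^ 'k. F ** E = mat 1}. D_s F A X)"

definition D_aL :: "real ^ 'k ^ 'm \<Rightarrow> nat \<Rightarrow> ereal" where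
  "D_aL E L = (INF A\<in>{A :: real set. finite A \<and> card A = L}. D_a E A (cball 0 1))"

definition gauss_space :: "('m \<times> 'k \<Rightarrow> real) measure" where
  "gauss_space = PiM UNIV (\<lambda>_. density lborel std_normal_density)"

definition gauss_mat :: "('m \<times> 'k \<Rightarrow> real) \<Rightarrow> real ^ 'k ^ 'm" where
  "gauss_mat \<omega> = (\<chi> i j. \<omega> (i, j))"

end

theory Submission
  imports Defs
begin

text \<open>
  Split \<open>l * N\<close> of the \<open>m\<close> rows of \<open>E\<close>, \<open>N = m div l\<close>, into \<open>l\<close> blocks of length \<open>N\<close>, and let \<open>V\<close>
  be the block-diagonal matrix with rows \<open>(\<beta>\<^sup>-\<^sup>1, \<dots>, \<beta>\<^sup>-\<^sup>N)\<close>. The left inverse is the beta dual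
  \<open>F = (V E)\<^sup>\<dagger> V\<close>. If the rows of \<open>E\<close> have norm at most \<open>\<mu>\<close>, then greedy noise shaping in each block
  with an equispaced alphabet of half-spacing \<open>\<delta> = \<mu> / (L - \<beta>)\<close> gives \<open>q\<close> with every entry of
  \<open>V (E x - q)\<close> at most \<open>\<delta> \<beta>\<^sup>-\<^sup>N\<close>, so the error is at most \<open>sqrt l * \<delta> * \<beta>\<^sup>-\<^sup>N / \<sigma>\<close> with \<open>\<sigma>\<close> the least
  singular value of \<open>V E\<close>. Up to a scalar factor at least \<open>1 / \<beta>\<close>, \<open>V E\<close> is an \<open>l \<times> k\<close> standard
  Gaussian matrix, so a net argument with chi-square tails bounds \<open>\<sigma>\<close> from below. The radix is
  \<open>\<beta> = L M / (M + 1)\<close> with \<open>M = (1 - \<eta>) N\<close>, and \<open>\<mu> = 4 sqrt m\<close>.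
\<close>

subsection \<open>Gaussian linear combinations and chi-square tails\<close>

lemma normal_square_mgf:
  assumes "a > -1/2"
  shows "(\<integral>\<^sup>+x. ennreal (std_normal_density x) * ennreal (exp (- a * x\<^sup>2)) \<partial>lborel)
    = ennreal (1 / sqrt (1 + 2 * a))"
proof -
  define c where "c = 1 / sqrt (1 + 2 * a)"
  have c: "c > 0" "c\<^sup>2 = 1 / (1 + 2 * a)" "1 + 2 * a > 0"
    using assms by (auto simp: c_def power_divide)
  have eq: "std_normal_density x * exp (- a * x\<^sup>2) = c * normal_density 0 c x" for x
  proof -
    have "std_normal_density x * exp (- a * x\<^sup>2) = 1 / sqrt (2 * pi) * exp (- x\<^sup>2 / 2 - a * x\<^sup>2)"
      by (simp add: std_normal_density_def exp_add[symmetric])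
    also have "- x\<^sup>2 / 2 - a * x\<^sup>2 = - x\<^sup>2 / (2 * c\<^sup>2)"
      using c(3) by (simp add: c(2) field_simps)
    finally show ?thesis
      using c(1) by (simp add: normal_density_def real_sqrt_mult)
  qed
  have "(\<integral>\<^sup>+x. ennreal (std_normal_density x) * ennreal (exp (- a * x\<^sup>2)) \<partial>lborel)
      = (\<integral>\<^sup>+x. ennreal c * ennreal (normal_density 0 c x) \<partial>lborel)"
    using c(1) by (simp add: ennreal_mult[symmetric] normal_density_nonneg del: mult_minus_left flip: eq)
  also have "\<dots> = ennreal c * (\<integral>\<^sup>+x. ennreal (normal_density 0 c x) \<partial>lborel)"
    by (rule nn_integral_cmult) auto
  also have "(\<integral>\<^sup>+x. ennreal (normal_density 0 c x) \<partial>lborel) = 1"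
    using c(1) by (subst nn_integral_eq_integral) (auto simp: normal_density_nonneg)
  finally show ?thesis by (simp add: c_def)
qed

lemma (in prob_space) nn_integral_exp_chi_square:
  assumes J: "finite J" and ind: "indep_vars (\<lambda>_. borel) Y J"
    and Y: "\<And>j. j \<in> J \<Longrightarrow> distributed M lborel (Y j) std_normal_density"
    and a: "a > -1/2"
  shows "(\<integral>\<^sup>+\<omega>. ennreal (exp (- a * (\<Sum>j\<in>J. (Y j \<omega>)\<^sup>2))) \<partial>M)
    = ennreal ((1 / sqrt (1 + 2 * a)) ^ card J)"
proof -
  have "(\<integral>\<^sup>+\<omega>. ennreal (exp (- a * (\<Sum>j\<in>J. (Y j \<omega>)\<^sup>2))) \<partial>M)
      = (\<integral>\<^sup>+\<omega>. (\<Prod>j\<in>J. ennreal (exp (- a * (Y j \<omega>)\<^sup>2))) \<partial>M)"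
    using J by (simp add: prod_ennreal exp_sum[symmetric] sum_distrib_left sum_negf)
  also have "\<dots> = (\<Prod>j\<in>J. \<integral>\<^sup>+\<omega>. ennreal (exp (- a * (Y j \<omega>)\<^sup>2)) \<partial>M)"
  proof (rule indep_vars_nn_integral[OF J])
    show "indep_vars (\<lambda>_. borel) (\<lambda>j \<omega>. ennreal (exp (- a * (Y j \<omega>)\<^sup>2))) J"
      by (rule indep_vars_compose2[OF ind, where Y="\<lambda>_ x. ennreal (exp (- a * x\<^sup>2))"]) measurable
  qed simp
  also have "\<dots> = (\<Prod>j\<in>J. ennreal (1 / sqrt (1 + 2 * a)))"
  proof (rule prod.cong[OF refl])
    fix j assume "j \<in> J"
    show "(\<integral>\<^sup>+\<omega>. ennreal (exp (- a * (Y j \<omega>)\<^sup>2)) \<partial>M) = ennreal (1 / sqrt (1 + 2 * a))"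
      using distributed_nn_integral[OF Y[OF \<open>j \<in> J\<close>], of "\<lambda>x. ennreal (exp (- a * x\<^sup>2))"]
        normal_square_mgf[OF a] by simp
  qed
  finally show ?thesis using a by (simp add: ennreal_power)
qed

text \<open>Markov's inequality for the exponential of \<open>- a\<close> times the sum. Keeping
  \<open>- a\<close> on both sides of the event lets one statement give lower tails for
  \<open>a > 0\<close> and upper tails for \<open>a < 0\<close>.\<close>

lemma (in prob_space) chernoff_chi_square:
  assumes J: "finite J" and ind: "indep_vars (\<lambda>_. borel) Y J"
    and Y: "\<And>j. j \<in> J \<Longrightarrow> distributed M lborel (Y j) std_normal_density"
    and a: "a > -1/2"
  shows "prob {\<omega> \<in> space M. - a * (\<Sum>j\<in>J. (Y j \<omega>)\<^sup>2) \<ge> - a * r}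
    \<le> exp (a * r) * (1 / sqrt (1 + 2 * a)) ^ card J"
proof -
  have [measurable]: "j \<in> J \<Longrightarrow> Y j \<in> borel_measurable M" for j
    using distributed_measurable[OF Y] by simp
  have "emeasure M {\<omega> \<in> space M. 1 \<le> ennreal (exp (a * r)) * ennreal (exp (- a * (\<Sum>j\<in>J. (Y j \<omega>)\<^sup>2)))}
     \<le> ennreal (exp (a * r)) *
        (\<integral>\<^sup>+\<omega>. ennreal (exp (- a * (\<Sum>j\<in>J. (Y j \<omega>)\<^sup>2))) * indicator (space M) \<omega> \<partial>M)"
    by (rule nn_integral_Markov_inequality) auto
  also have "(\<integral>\<^sup>+\<omega>. ennreal (exp (- a * (\<Sum>j\<in>J. (Y j \<omega>)\<^sup>2))) * indicator (space M) \<omega> \<partial>M)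
     = ennreal ((1 / sqrt (1 + 2 * a)) ^ card J)"
    using nn_integral_exp_chi_square[OF assms]
    by (subst nn_integral_cong[where v="\<lambda>\<omega>. ennreal (exp (- a * (\<Sum>j\<in>J. (Y j \<omega>)\<^sup>2)))"]) auto
  also have "{\<omega> \<in> space M. 1 \<le> ennreal (exp (a * r)) * ennreal (exp (- a * (\<Sum>j\<in>J. (Y j \<omega>)\<^sup>2)))}
     = {\<omega> \<in> space M. - a * (\<Sum>j\<in>J. (Y j \<omega>)\<^sup>2) \<ge> - a * r}"
    by (auto simp: ennreal_mult[symmetric] exp_add[symmetric] simp flip: ennreal_1)
  finally show ?thesis
    using a by (simp add: emeasure_eq_measure ennreal_mult[symmetric])
qed

lemma (in prob_space) chi_square_lower_tail:
  fixes t :: real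
  assumes J: "finite J" and ind: "indep_vars (\<lambda>_. borel) Y J"
    and Y: "\<And>j. j \<in> J \<Longrightarrow> distributed M lborel (Y j) std_normal_density"
    and t: "0 < t" "t < 1"
  shows "prob {\<omega> \<in> space M. (\<Sum>j\<in>J. (Y j \<omega>)\<^sup>2) \<le> t\<^sup>2 * card J} \<le> exp (card J / 2) * t ^ card J"
proof -
  \<comment> \<open>This value minimises the Chernoff bound and makes
    \<open>1 / sqrt (1 + 2 * a)\<close> equal to \<open>t\<close>.\<close>
  define a where "a = (1 / t\<^sup>2 - 1) / 2"
  have "t\<^sup>2 < 1" using t by (simp add: power_less_one_iff)
  then have a: "a > 0" using t by (simp add: a_def)
  have sq: "sqrt (1 + 2 * a) = 1 / t"
  proof -
    have "1 + 2 * a = (1 / t)\<^sup>2" by (simp add: a_def power_divide diff_divide_distrib)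
    then show ?thesis using t by simp
  qed
  have "a * (t\<^sup>2 * card J) = (1 - t\<^sup>2) * card J / 2"
    using t by (simp add: a_def field_simps)
  also have "\<dots> \<le> card J / 2"
    by (simp add: mult_left_le_one_le algebra_simps)
  finally have le: "a * (t\<^sup>2 * card J) \<le> card J / 2" .
  have "prob {\<omega> \<in> space M. (\<Sum>j\<in>J. (Y j \<omega>)\<^sup>2) \<le> t\<^sup>2 * card J}
      = prob {\<omega> \<in> space M. - a * (\<Sum>j\<in>J. (Y j \<omega>)\<^sup>2) \<ge> - a * (t\<^sup>2 * card J)}"
    using a by (intro arg_cong[where f=prob]) (auto simp: mult_le_cancel_left)
  also have "\<dots> \<le> exp (a * (t\<^sup>2 * card J)) * (1 / sqrt (1 + 2 * a)) ^ card J"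
    using a by (intro chernoff_chi_square[OF J ind Y]) auto
  also have "\<dots> = exp (a * (t\<^sup>2 * card J)) * t ^ card J"
    by (simp add: sq)
  also have "\<dots> \<le> exp (card J / 2) * t ^ card J"
    using le t by (intro mult_right_mono) auto
  finally show ?thesis .
qed

text \<open>The decay \<open>exp (- r / 4)\<close> suffices for what follows, so the exponent is
  fixed at \<open>a = -1/4\<close> instead of being optimised in \<open>r\<close>.\<close>

lemma (in prob_space) chi_square_upper_tail:
  assumes J: "finite J" and ind: "indep_vars (\<lambda>_. borel) Y J"
    and Y: "\<And>j. j \<in> J \<Longrightarrow> distributed M lborel (Y j) std_normal_density"
  shows "prob {\<omega> \<in> space M. (\<Sum>j\<in>J. (Y j \<omega>)\<^sup>2) \<ge> r} \<le> sqrt 2 ^ card J * exp (- r / 4)"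
proof -
  have "prob {\<omega> \<in> space M. (\<Sum>j\<in>J. (Y j \<omega>)\<^sup>2) \<ge> r}
      = prob {\<omega> \<in> space M. - (- 1/4) * (\<Sum>j\<in>J. (Y j \<omega>)\<^sup>2) \<ge> - (- 1/4) * r}"
    by simp
  also have "\<dots> \<le> exp ((- 1/4) * r) * (1 / sqrt (1 + 2 * (- 1/4))) ^ card J"
    by (rule chernoff_chi_square[OF J ind Y]) auto
  finally show ?thesis by (simp add: real_sqrt_divide mult.commute)
qed

section \<open>Matrix entries as independent normal variables\<close>

lemma prob_space_gauss_space: "prob_space (gauss_space :: ('m::finite \<times> 'k::finite \<Rightarrow> real) measure)"
  unfolding gauss_space_def by (intro prob_space_PiM prob_space_normal_density) auto

lemma space_gauss_space [simp]: "space (gauss_space :: ('m::finite \<times> 'k::finite \<Rightarrow> real) measure) = UNIV"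
  by (auto simp: gauss_space_def space_PiM PiE_def)

lemma measurable_gauss_component [measurable]:
  "(\<lambda>\<omega>. \<omega> p) \<in> borel_measurable (gauss_space :: ('m::finite \<times> 'k::finite \<Rightarrow> real) measure)"
proof -
  have "(\<lambda>\<omega>. \<omega> p) \<in> (gauss_space :: ('m \<times> 'k \<Rightarrow> real) measure) \<rightarrow>\<^sub>M density lborel std_normal_density"
    unfolding gauss_space_def by (rule measurable_component_singleton) simp
  then show ?thesis by (simp cong: measurable_cong_sets)
qed

lemma distributed_gauss_component:
  "distributed (gauss_space :: ('m::finite \<times> 'k::finite \<Rightarrow> real) measure) lborel (\<lambda>\<omega>. \<omega> p) std_normal_density"
proof -
  let ?D = "density lborel std_normal_density"
  have "distr (gauss_space :: ('m \<times> 'k \<Rightarrow> real) measure) ?D (\<lambda>\<omega>. \<omega> p) = ?D"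
    unfolding gauss_space_def
    by (rule distr_PiM_component) (auto intro: prob_space_normal_density)
  moreover have "distr (gauss_space :: ('m \<times> 'k \<Rightarrow> real) measure) ?D (\<lambda>\<omega>. \<omega> p)
      = distr gauss_space lborel (\<lambda>\<omega>. \<omega> p)"
    by (rule distr_cong) auto
  ultimately show ?thesis
    unfolding distributed_def by simp
qed

text \<open>Independence is read off the joint law: an injective selection of coordinates maps the
  product measure to the product of the marginals.\<close>

lemma indep_vars_gauss_reindex:
  fixes f :: "'i \<Rightarrow> 'm::finite \<times> 'k::finite"
  assumes f: "inj_on f I" and I: "I \<noteq> {}"
  shows "prob_space.indep_vars (gauss_space :: ('m \<times> 'k \<Rightarrow> real) measure)
     (\<lambda>_. borel) (\<lambda>i \<omega>. \<omega> (f i)) I"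
proof -
  interpret G: prob_space "gauss_space :: ('m \<times> 'k \<Rightarrow> real) measure"
    by (rule prob_space_gauss_space)
  let ?D = "density lborel std_normal_density"
  have d: "distr gauss_space borel (\<lambda>\<omega>. \<omega> p) = ?D" for p :: "'m \<times> 'k"
    using distributed_gauss_component[of p] unfolding distributed_def
    by (metis (no_types, lifting) distr_cong sets_lborel)
  have "distr (gauss_space :: ('m \<times> 'k \<Rightarrow> real) measure) (PiM I (\<lambda>_. borel)) (\<lambda>\<omega>. \<lambda>i\<in>I. \<omega> (f i))
     = distr gauss_space (PiM I (\<lambda>_. ?D)) (\<lambda>\<omega>. \<lambda>i\<in>I. \<omega> (f i))"
    by (rule distr_cong) (auto intro!: sets_PiM_cong)
  also have "\<dots> = PiM I (\<lambda>_. ?D)"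
    unfolding gauss_space_def
    by (rule distr_PiM_reindex[OF _ f]) (auto intro: prob_space_normal_density)
  also have "\<dots> = PiM I (\<lambda>i. distr gauss_space borel (\<lambda>\<omega>. \<omega> (f i)))"
    by (simp add: d)
  finally show ?thesis
    using I by (subst G.indep_vars_iff_distr_eq_PiM') auto
qed

lemma distributed_gauss_linear_combination:
  fixes f :: "'i \<Rightarrow> 'm::finite \<times> 'k::finite" and a :: "'i \<Rightarrow> real"
  assumes I: "finite I" and f: "inj_on f I" and s: "(\<Sum>i\<in>I. (a i)\<^sup>2) = s\<^sup>2" "s > 0"
  shows "distributed (gauss_space :: ('m \<times> 'k \<Rightarrow> real) measure) lborel
    (\<lambda>\<omega>. (\<Sum>i\<in>I. a i * \<omega> (f i)) / s) std_normal_density"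
proof -
  interpret G: prob_space "gauss_space :: ('m \<times> 'k \<Rightarrow> real) measure"
    by (rule prob_space_gauss_space)
  \<comment> \<open>Zero coefficients are discarded, since the sum rule for independent normals asks
    for positive standard deviations.\<close>
  define I' where "I' = {i \<in> I. a i \<noteq> 0}"
  have I': "finite I'" "inj_on f I'"
    using I f by (auto simp: I'_def intro: inj_on_subset)
  have sum: "(\<Sum>i\<in>I'. (a i)\<^sup>2) = s\<^sup>2" "(\<Sum>i\<in>I'. a i * \<omega> (f i)) = (\<Sum>i\<in>I. a i * \<omega> (f i))" for \<omega>
    unfolding s(1)[symmetric] by (intro sum.mono_neutral_left; auto simp: I'_def I)+
  have ne: "I' \<noteq> {}" using sum(1) s(2) by auto
  have "distributed gauss_space lborel (\<lambda>\<omega>. \<Sum>i\<in>I'. a i * \<omega> (f i))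
     (normal_density (\<Sum>i\<in>I'. 0) (sqrt (\<Sum>i\<in>I'. \<bar>a i\<bar>\<^sup>2)))"
  proof (rule G.sum_indep_normal[OF I'(1) ne])
    show "G.indep_vars (\<lambda>_. borel) (\<lambda>i \<omega>. a i * \<omega> (f i)) I'"
      by (rule G.indep_vars_compose2[OF indep_vars_gauss_reindex[OF I'(2) ne],
            where Y="\<lambda>i x. a i * x"]) measurable
    fix i assume "i \<in> I'"
    then have "a i \<noteq> 0" by (simp add: I'_def)
    then show "0 < \<bar>a i\<bar>"
      and "distributed gauss_space lborel (\<lambda>\<omega>. a i * \<omega> (f i)) (normal_density 0 \<bar>a i\<bar>)"
      using G.normal_density_affine[OF distributed_gauss_component, of "a i" 0 "f i"] by auto
  qed
  then have "distributed gauss_space lborel (\<lambda>\<omega>. \<Sum>i\<in>I. a i * \<omega> (f i)) (normal_density 0 s)"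
    using s(2) by (simp add: sum)
  then show ?thesis
    using G.normal_standard_normal_convert[OF s(2), of _ 0] by simp
qed

text \<open>Each combination depends only on its own block of coordinates, and injectivity of
  \<open>p\<close> on all pairs keeps the blocks disjoint.\<close>

lemma indep_vars_gauss_linear_combinations:
  fixes p :: "'j \<Rightarrow> 'i \<Rightarrow> 'm::finite \<times> 'k::finite" and a :: "'i \<Rightarrow> real"
  assumes J: "J \<noteq> {}" and I: "I \<noteq> {}" and p: "inj_on (\<lambda>(j, i). p j i) (J \<times> I)"
  shows "prob_space.indep_vars (gauss_space :: ('m \<times> 'k \<Rightarrow> real) measure)
    (\<lambda>_. borel) (\<lambda>j \<omega>. (\<Sum>i\<in>I. a i * \<omega> (p j i)) / s) J"
proof -
  interpret G: prob_space "gauss_space :: ('m \<times> 'k \<Rightarrow> real) measure"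
    by (rule prob_space_gauss_space)
  have ne: "J \<times> I \<noteq> {}" using J I by auto
  have "G.indep_vars (\<lambda>j. PiM ({j} \<times> I) (\<lambda>_. borel))
      (\<lambda>j \<omega>. \<lambda>q\<in>{j} \<times> I. \<omega> ((\<lambda>(j, i). p j i) q)) J"
    by (rule G.indep_vars_restrict[OF indep_vars_gauss_reindex[OF p ne]])
       (auto simp: disjoint_family_on_def)
  then have "G.indep_vars (\<lambda>_. borel) (\<lambda>j \<omega>. (\<lambda>x. (\<Sum>i\<in>I. a i * x (j, i)) / s)
      (\<lambda>q\<in>{j} \<times> I. \<omega> ((\<lambda>(j, i). p j i) q))) J"
    by (rule G.indep_vars_compose2) measurable
  then show ?thesis by simp
qed

text \<open>\<open>Y j\<close> is an entry of the condensed matrix applied to the unit vector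
  \<open>y\<close>, divided by \<open>s\<close>. Expanding the inner product gives coefficients
  \<open>b n * y $ c\<close>, whose squares sum to \<open>s\<^sup>2\<close>.\<close>

lemma
  fixes idx :: "nat \<Rightarrow> nat \<Rightarrow> 'm::finite" and y :: "real ^ 'k"
  assumes idx: "inj_on (\<lambda>(j, n). idx j n) ({..<l} \<times> {..<N})"
    and l: "l > 0" and b: "(\<Sum>n<N. (b n)\<^sup>2) = s\<^sup>2" "s > 0" and y: "norm y = 1"
  defines "Y \<equiv> \<lambda>j (\<omega> :: 'm \<times> 'k \<Rightarrow> real). (\<Sum>n<N. b n *\<^sub>R gauss_mat \<omega> $ idx j n) \<bullet> y / s"
  shows distributed_block_inner: "j < l \<Longrightarrow> distributed gauss_space lborel (Y j) std_normal_density"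
    and indep_vars_block_inner: "prob_space.indep_vars gauss_space (\<lambda>_. borel) Y {..<l}"
proof -
  define a where "a = (\<lambda>(n, c). b n * y $ c)"
  define p where "p = (\<lambda>j (n, c::'k). (idx j n, c))"
  let ?I = "{..<N} \<times> (UNIV :: 'k set)"
  have Y: "Y = (\<lambda>j \<omega>. (\<Sum>i\<in>?I. a i * \<omega> (p j i)) / s)"
  proof (intro ext)
    fix j and \<omega> :: "'m \<times> 'k \<Rightarrow> real"
    have "(\<Sum>n<N. b n *\<^sub>R gauss_mat \<omega> $ idx j n) \<bullet> y
        = (\<Sum>n<N. \<Sum>c\<in>UNIV. b n * y $ c * \<omega> (idx j n, c))"
      unfolding inner_sum_left inner_scaleR_left
      by (simp add: inner_vec_def gauss_mat_def sum_distrib_left mult_ac)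
    also have "\<dots> = (\<Sum>i\<in>?I. a i * \<omega> (p j i))"
      by (simp add: sum.cartesian_product a_def p_def case_prod_beta')
    finally show "Y j \<omega> = (\<Sum>i\<in>?I. a i * \<omega> (p j i)) / s" by (simp add: Y_def)
  qed
  have "N > 0" using b by (cases N) auto
  have "y \<bullet> y = 1" using y by (simp add: dot_square_norm)
  then have "(\<Sum>c\<in>UNIV. (y $ c)\<^sup>2) = 1" by (simp add: inner_vec_def power2_eq_square)
  moreover have "(\<Sum>i\<in>?I. (a i)\<^sup>2) = (\<Sum>n<N. \<Sum>c\<in>UNIV. (b n)\<^sup>2 * (y $ c)\<^sup>2)"
    by (simp add: sum.cartesian_product a_def case_prod_beta' power_mult_distrib)
  ultimately have a: "(\<Sum>i\<in>?I. (a i)\<^sup>2) = s\<^sup>2"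
    using b(1) by (simp add: sum_distrib_left[symmetric])
  have p: "inj_on (\<lambda>(j, i). p j i) ({..<l} \<times> ?I)"
    using idx by (auto simp: p_def inj_on_def)
  show "prob_space.indep_vars gauss_space (\<lambda>_. borel) Y {..<l}"
    unfolding Y using l \<open>N > 0\<close> by (intro indep_vars_gauss_linear_combinations p) auto
  show "distributed gauss_space lborel (Y j) std_normal_density" if "j < l"
    unfolding Y
  proof (rule distributed_gauss_linear_combination[OF _ _ a b(2)])
    show "inj_on (p j) ?I" using p that by (fastforce simp: inj_on_def)
  qed simp
qed

subsection \<open>Nets on the sphere\<close>

text \<open>Volume comparison: the balls of radius \<open>\<epsilon>/2\<close> about the points are
  disjoint and lie in the ball of radius \<open>1 + \<epsilon>/2\<close> about 0.\<close>

lemma card_separated_unit_vectors_le: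
  fixes X :: "'a::euclidean_space set"
  assumes fin: "finite X" and X: "X \<subseteq> sphere 0 1" and \<epsilon>: "0 < \<epsilon>"
    and sep: "\<And>x y. x \<in> X \<Longrightarrow> y \<in> X \<Longrightarrow> x \<noteq> y \<Longrightarrow> dist x y > \<epsilon>"
  shows "real (card X) \<le> (1 + 2 / \<epsilon>) ^ DIM('a)"
proof -
  let ?v = "unit_ball_vol (real DIM('a))"
  have disj: "disjoint_family_on (\<lambda>x. ball x (\<epsilon>/2)) X"
    unfolding disjoint_family_on_def
  proof (intro ballI impI)
    fix x y assume xy: "x \<in> X" "y \<in> X" "x \<noteq> y"
    show "ball x (\<epsilon>/2) \<inter> ball y (\<epsilon>/2) = {}"
      using sep[OF xy] by (intro disjoint_ballI) simp
  qed
  have sub: "(\<Union>x\<in>X. ball x (\<epsilon>/2)) \<subseteq> ball 0 (1 + \<epsilon>/2)"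
  proof safe
    fix x y assume "x \<in> X" "y \<in> ball x (\<epsilon>/2)"
    then show "y \<in> ball 0 (1 + \<epsilon>/2)"
      using X norm_triangle_ineq2[of y x] by (auto simp: dist_norm norm_minus_commute)
  qed
  have "real (card X) * (?v * (\<epsilon>/2) ^ DIM('a)) = (\<Sum>x\<in>X. measure lborel (ball x (\<epsilon>/2)))"
    using \<epsilon> by (simp add: content_ball)
  also have "\<dots> = measure lborel (\<Union>x\<in>X. ball x (\<epsilon>/2))"
    using fin disj by (intro measure_finite_Union[symmetric]) (auto simp: emeasure_ball less_imp_le[OF \<epsilon>])
  also have "\<dots> \<le> measure lborel (ball (0::'a) (1 + \<epsilon>/2))"
    by (rule measure_mono_fmeasurable[OF sub]) (use fin in \<open>auto simp: fmeasurable_def emeasure_ball less_imp_le[OF \<epsilon>]\<close>)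
  also have "\<dots> = ?v * (1 + \<epsilon>/2) ^ DIM('a)"
    using \<epsilon> by (simp add: content_ball)
  finally have "?v * (real (card X) * (\<epsilon>/2) ^ DIM('a)) \<le> ?v * (1 + \<epsilon>/2) ^ DIM('a)"
    by (simp only: mult_ac)
  then have "real (card X) * (\<epsilon>/2) ^ DIM('a) \<le> (1 + \<epsilon>/2) ^ DIM('a)"
    by (subst (asm) mult_le_cancel_left_pos) simp_all
  also have "1 + \<epsilon>/2 = (1 + 2/\<epsilon>) * (\<epsilon>/2)"
    using \<epsilon> by (simp add: field_simps)
  also have "((1 + 2/\<epsilon>) * (\<epsilon>/2)) ^ DIM('a) = (1 + 2/\<epsilon>) ^ DIM('a) * (\<epsilon>/2) ^ DIM('a)"
    by (rule power_mult_distrib)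
  finally show ?thesis
    using \<epsilon> by (subst (asm) mult_le_cancel_right_pos) simp_all
qed

text \<open>A separated subset of largest cardinality is a net, since an uncovered point could be
  added to it. The volume bound guarantees that a largest one exists.\<close>

lemma exists_sphere_net:
  fixes \<epsilon> :: real
  assumes \<epsilon>: "0 < \<epsilon>"
  obtains X :: "'a::euclidean_space set" where "finite X" "X \<subseteq> sphere 0 1"
    "\<And>x. x \<in> sphere 0 1 \<Longrightarrow> \<exists>y\<in>X. dist x y \<le> \<epsilon>"
    "real (card X) \<le> (1 + 2 / \<epsilon>) ^ DIM('a)"
proof -
  define P :: "'a set \<Rightarrow> bool" where
    "P X \<longleftrightarrow> finite X \<and> X \<subseteq> sphere 0 1 \<and> (\<forall>x\<in>X. \<forall>y\<in>X. x \<noteq> y \<longrightarrow> dist x y > \<epsilon>)" for X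
  have bound: "card X \<le> nat \<lfloor>(1 + 2 / \<epsilon>) ^ DIM('a)\<rfloor>" if "P X" for X
  proof -
    have "real (card X) \<le> (1 + 2 / \<epsilon>) ^ DIM('a)"
      by (rule card_separated_unit_vectors_le) (use that \<epsilon> in \<open>auto simp: P_def\<close>)
    then show ?thesis by (simp add: le_nat_floor)
  qed
  have "P {}" by (simp add: P_def)
  then have "\<exists>X. P X \<and> (\<forall>Y. P Y \<longrightarrow> card Y \<le> card X)"
    using bound by (intro ex_has_greatest_nat[of P "{}" card "Suc (nat \<lfloor>(1 + 2 / \<epsilon>) ^ DIM('a)\<rfloor>)"])
      (auto simp: less_Suc_eq_le)
  then obtain X where X: "P X" "\<And>Y. P Y \<Longrightarrow> card Y \<le> card X" by metis
  have "\<exists>y\<in>X. dist x y \<le> \<epsilon>" if x: "x \<in> sphere 0 1" for x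
  proof (rule ccontr)
    assume "\<not> ?thesis"
    then have far: "\<And>y. y \<in> X \<Longrightarrow> dist x y > \<epsilon>" by force
    then have "x \<notin> X" using \<epsilon> by force
    moreover have "P (insert x X)"
      using X(1) x far by (auto simp: P_def dist_commute)
    ultimately show False
      using X(2)[of "insert x X"] X(1) by (simp add: P_def)
  qed
  moreover have "real (card X) \<le> (1 + 2 / \<epsilon>) ^ DIM('a)"
    by (rule card_separated_unit_vectors_le) (use X(1) \<epsilon> in \<open>auto simp: P_def\<close>)
  ultimately show thesis
    using that X(1) by (auto simp: P_def)
qed

text \<open>Let \<open>R\<close> be the supremum of \<open>f\<close> on the sphere, finite thanks to
  \<open>B\<close>. Moving to a net point gives \<open>R \<le> K + \<epsilon> * R\<close>, so
  \<open>R \<le> K / (1 - \<epsilon>)\<close>. The same move then takes at most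
  \<open>\<epsilon> * R\<close> off the lower bound \<open>t\<close>.\<close>

lemma seminorm_lower_bound_from_net:
  fixes f :: "'a::euclidean_space \<Rightarrow> real"
  assumes sub: "\<And>x y. f (x + y) \<le> f x + f y"
    and hom: "\<And>c x. f (c *\<^sub>R x) = \<bar>c\<bar> * f x"
    and bnd: "\<And>x. f x \<le> B * norm x"
    and X: "X \<subseteq> sphere 0 1" "\<And>x. x \<in> sphere 0 1 \<Longrightarrow> \<exists>y\<in>X. dist x y \<le> \<epsilon>"
    and \<epsilon>: "0 < \<epsilon>" "\<epsilon> < 1"
    and lo: "\<And>y. y \<in> X \<Longrightarrow> t \<le> f y" and hi: "\<And>y. y \<in> X \<Longrightarrow> f y \<le> K"
  shows "(t - \<epsilon> * K / (1 - \<epsilon>)) * norm x \<le> f x"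
proof -
  define R where "R = (SUP u\<in>sphere 0 1. f u)"
  obtain e :: 'a where e: "norm e = 1" using nonempty_Basis norm_Basis by blast
  then have ne: "sphere (0::'a) 1 \<noteq> {}" by auto
  have bdd: "bdd_above (f ` sphere 0 1)"
  proof (rule bdd_aboveI2)
    show "f u \<le> B" if "u \<in> sphere 0 1" for u using bnd[of u] that by simp
  qed
  have R: "f x \<le> R * norm x" for x
  proof (cases "x = 0")
    case True then show ?thesis using hom[of 0 0] by simp
  next
    case False
    then have "f (x /\<^sub>R norm x) \<le> R"
      unfolding R_def by (intro cSUP_upper[OF _ bdd]) simp
    then show ?thesis using False by (simp add: hom field_simps)
  qed
  have R0: "f u \<le> K + \<epsilon> * R" if u: "u \<in> sphere 0 1" and "R \<ge> 0" for u
  proof -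
    obtain y where y: "y \<in> X" "dist u y \<le> \<epsilon>" using X(2)[OF u] by blast
    have "f u \<le> f y + f (u - y)" using sub[of y "u - y"] by simp
    also have "f (u - y) \<le> R * norm (u - y)" by (rule R)
    also have "\<dots> \<le> R * \<epsilon>" using y(2) that by (intro mult_left_mono) (auto simp: dist_norm)
    finally show ?thesis using hi[OF y(1)] by (simp add: mult.commute)
  qed
  have "f x \<ge> 0" for x
    using sub[of x "- x"] hom[of "-1" x] hom[of 0 x] by simp
  then have Rn: "R \<ge> 0"
    using order_trans[OF _ R[of e]] e by simp
  have "R \<le> K + \<epsilon> * R"
    using cSUP_least[OF ne, of f "K + \<epsilon> * R"] R0[OF _ Rn] by (simp only: R_def[symmetric])
  then have RK: "R \<le> K / (1 - \<epsilon>)" using \<epsilon> by (simp add: field_simps)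
  have unit: "t - \<epsilon> * K / (1 - \<epsilon>) \<le> f u" if u: "u \<in> sphere 0 1" for u
  proof -
    obtain y where y: "y \<in> X" "dist u y \<le> \<epsilon>" using X(2)[OF u] by blast
    have "f y \<le> f u + f (y - u)" using sub[of u "y - u"] by simp
    also have "f (y - u) \<le> R * norm (y - u)" by (rule R)
    also have "\<dots> \<le> R * \<epsilon>"
      using y(2) Rn by (intro mult_left_mono) (auto simp: dist_norm norm_minus_commute)
    also have "\<dots> \<le> K / (1 - \<epsilon>) * \<epsilon>" using RK \<epsilon> by (intro mult_right_mono) auto
    finally show ?thesis using lo[OF y(1)] by (simp add: mult.commute)
  qed
  show ?thesis
  proof (cases "x = 0")
    case True then show ?thesis using hom[of 0 0] by simp
  next
    case False
    then have "t - \<epsilon> * K / (1 - \<epsilon>) \<le> f (x /\<^sub>R norm x)"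
      by (intro unit) simp
    then show ?thesis using False by (simp add: hom field_simps)
  qed
qed

subsection \<open>Singular values of the condensed Gaussian matrix\<close>

lemma sqrt2_le_exp_half: "sqrt 2 \<le> exp (1/2 :: real)"
proof -
  have "(exp (1/2 :: real))\<^sup>2 = exp 1" by (simp add: power2_eq_square flip: exp_add)
  moreover have "(2::real) \<le> exp 1" using exp_ge_add_one_self[of 1] by simp
  ultimately show ?thesis by (intro real_le_lsqrt) auto
qed

text \<open>At each net point the two chi-square tails together cost at most
  \<open>exp (l / 2) * \<theta> ^ l\<close>. Up to logarithmic factors in the base, the net has
  \<open>(1 / \<theta>) ^ CARD('k)\<close> points, so the union bound leaves
  \<open>\<theta> ^ (l - CARD('k))\<close>.\<close>

lemma block_singular_value_bound:
  fixes idx :: "nat \<Rightarrow> nat \<Rightarrow> 'm::finite" and b :: "nat \<Rightarrow> real" and N :: nat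
  defines "W \<equiv> \<lambda>(\<omega> :: 'm \<times> 'k::finite \<Rightarrow> real) j. \<Sum>n<N. b n *\<^sub>R gauss_mat \<omega> $ idx j n"
  assumes idx: "inj_on (\<lambda>(j, n). idx j n) ({..<l} \<times> {..<N})"
    and l: "l > CARD('k)" and b: "(\<Sum>n<N. (b n)\<^sup>2) = s\<^sup>2" "s > 0" and \<theta>: "0 < \<theta>" "\<theta> \<le> 1"
  obtains S where "S \<in> sets (gauss_space :: ('m \<times> 'k \<Rightarrow> real) measure)"
    "measure gauss_space (- S) \<le> exp (real l / 2) * (10 + 8 * sqrt (ln (1 / \<theta>))) ^ CARD('k) * \<theta> ^ (l - CARD('k))"
    "\<And>\<omega> x. \<omega> \<in> S \<Longrightarrow> s * \<theta> * sqrt (real l) / 4 * norm x \<le> L2_set (\<lambda>j. W \<omega> j \<bullet> x) {..<l}"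
proof -
  interpret G: prob_space "gauss_space :: ('m \<times> 'k \<Rightarrow> real) measure"
    by (rule prob_space_gauss_space)
  have l2: "l \<ge> 2" "l > 0" using l zero_less_card_finite[where 'a='k] by linarith+
  define \<tau> where "\<tau> = sqrt (ln (1 / \<theta>))"
  have \<tau>: "\<tau> \<ge> 0" "\<theta> = exp (- \<tau>\<^sup>2)"
    using \<theta> by (auto simp: \<tau>_def ln_div)
  \<comment> \<open>On a net of mesh \<open>\<epsilon>\<close> the values lie between \<open>7/8 * \<theta>\<close> and \<open>K\<close> (in units of \<open>s * sqrt l\<close>);
    \<open>\<epsilon>\<close> is chosen so that passing to the whole sphere costs \<open>\<epsilon> * K / (1 - \<epsilon>) = 5/8 * \<theta>\<close>, leaving \<open>\<theta> / 4\<close>.\<close>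
  define K where "K = 2 + 5 / 2 * \<tau>"
  define d where "d = 5 / 8 * \<theta>"
  define \<epsilon> where "\<epsilon> = d / (K + d)"
  have K: "K > 0" using \<tau> by (simp add: K_def)
  have d: "d > 0" using \<theta> by (simp add: d_def)
  have \<epsilon>: "0 < \<epsilon>" "\<epsilon> < 1" using K d by (auto simp: \<epsilon>_def)
  have "1 - \<epsilon> = K / (K + d)" using K d by (simp add: \<epsilon>_def field_simps)
  then have \<epsilon>K: "\<epsilon> * K / (1 - \<epsilon>) = d" using K d by (simp add: \<epsilon>_def)
  obtain X :: "(real ^ 'k) set" where X: "finite X" "X \<subseteq> sphere 0 1"
    "\<And>x. x \<in> sphere 0 1 \<Longrightarrow> \<exists>y\<in>X. dist x y \<le> \<epsilon>"
    "real (card X) \<le> (1 + 2 / \<epsilon>) ^ CARD('k)"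
    using exists_sphere_net[OF \<epsilon>(1)] by (metis DIM_cart DIM_real mult_1_right)
  define Z where "Z y \<omega> = (\<Sum>j<l. (W \<omega> j \<bullet> y / s)\<^sup>2)" for y \<omega>
  have [measurable]: "(\<lambda>\<omega>. W \<omega> j \<bullet> y / s) \<in> borel_measurable gauss_space" for j y
    unfolding W_def gauss_mat_def inner_sum_left inner_scaleR_left inner_vec_def
    by simp
  have [measurable]: "Z y \<in> borel_measurable gauss_space" for y
    unfolding Z_def by measurable
  define Bad where "Bad y = {\<omega> \<in> space gauss_space. Z y \<omega> \<le> (7 / 8 * \<theta>)\<^sup>2 * card {..<l}}
    \<union> {\<omega> \<in> space gauss_space. Z y \<omega> \<ge> K\<^sup>2 * l}" for y
  have Bad_sets [measurable]: "Bad y \<in> sets gauss_space" for y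
    unfolding Bad_def by measurable
  have Bad_prob: "G.prob (Bad y) \<le> exp (real l / 2) * \<theta> ^ l" if "y \<in> X" for y
  proof -
    have y: "norm y = 1" using that X(2) by auto
    have dist: "distributed gauss_space lborel (\<lambda>\<omega>. W \<omega> j \<bullet> y / s) std_normal_density" if "j \<in> {..<l}" for j
      using distributed_block_inner[OF idx l2(2) b y, of j] that by (simp add: W_def)
    have indep: "G.indep_vars (\<lambda>_. borel) (\<lambda>j \<omega>. W \<omega> j \<bullet> y / s) {..<l}"
      unfolding W_def by (rule indep_vars_block_inner[OF idx l2(2) b y])
    have "G.prob {\<omega> \<in> space gauss_space. Z y \<omega> \<le> (7 / 8 * \<theta>)\<^sup>2 * card {..<l}}
        \<le> exp (card {..<l} / 2) * (7 / 8 * \<theta>) ^ card {..<l}"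
      unfolding Z_def
      by (rule G.chi_square_lower_tail[OF _ indep dist]) (use \<theta> in auto)
    then have lower: "G.prob {\<omega> \<in> space gauss_space. Z y \<omega> \<le> (7 / 8 * \<theta>)\<^sup>2 * card {..<l}}
        \<le> exp (l / 2) * \<theta> ^ l * (7 / 8) ^ l"
      unfolding power_mult_distrib[of "7 / 8"] by (simp add: mult_ac)
    have "G.prob {\<omega> \<in> space gauss_space. Z y \<omega> \<ge> K\<^sup>2 * l} \<le> sqrt 2 ^ card {..<l} * exp (- (K\<^sup>2 * l) / 4)"
      unfolding Z_def by (rule G.chi_square_upper_tail[OF _ indep dist]) auto
    also have "\<dots> = (sqrt 2 * exp (- (K\<^sup>2 / 4))) ^ l"
      by (simp add: power_mult_distrib exp_of_nat_mult[symmetric] mult_ac)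
    \<comment> \<open>\<open>K\<close> is large enough that
      \<open>K\<^sup>2 / 4 \<ge> \<tau>\<^sup>2 + 1\<close>: the term \<open>\<tau>\<^sup>2\<close>
      produces \<open>\<theta>\<close>, and the term 1 the small factor
      \<open>exp (- real l)\<close>.\<close>
    also have "\<dots> \<le> (exp (1/2) * (exp (- \<tau>\<^sup>2) * exp (- 1))) ^ l"
    proof (intro power_mono mult_mono sqrt2_le_exp_half)
      have "\<tau>\<^sup>2 + 1 \<le> K\<^sup>2 / 4"
      proof -
        have "K\<^sup>2 / 4 = \<tau>\<^sup>2 + 1 + (5 / 2 * \<tau> + 9 / 16 * \<tau>\<^sup>2)"
          by (simp add: K_def power2_eq_square field_simps)
        moreover have "5 / 2 * \<tau> + 9 / 16 * \<tau>\<^sup>2 \<ge> 0" using \<tau>(1) by simp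
        ultimately show ?thesis by linarith
      qed
      then show "exp (- (K\<^sup>2 / 4)) \<le> exp (- \<tau>\<^sup>2) * exp (- 1)"
        by (simp flip: exp_add)
    qed auto
    also have "\<dots> = exp (l / 2) * \<theta> ^ l * exp (- real l)"
      by (simp add: power_mult_distrib \<tau>(2) exp_of_nat_mult[symmetric])
    finally have upper: "G.prob {\<omega> \<in> space gauss_space. Z y \<omega> \<ge> K\<^sup>2 * l}
      \<le> exp (l / 2) * \<theta> ^ l * exp (- real l)" .
    \<comment> \<open>Both tails fit under one bound because \<open>l \<ge> 2\<close>, as
      \<open>49/64 + 1/5 < 1\<close>. For \<open>l = 1\<close> the sum would exceed 1.\<close>
    have "(7 / 8 :: real) ^ l \<le> (7 / 8) ^ 2" using l2 by (intro power_decreasing) auto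
    moreover have "exp (- real l) \<le> 1 / 5"
    proof -
      have "5 \<le> exp (2::real)" using exp_lower_Taylor_quadratic[of 2] by simp
      also have "\<dots> \<le> exp (real l)" using l2 by simp
      finally show ?thesis by (simp add: exp_minus field_simps)
    qed
    ultimately have "(7 / 8 :: real) ^ l + exp (- real l) \<le> 1"
      by (simp add: power2_eq_square)
    then have "exp (l / 2) * \<theta> ^ l * ((7 / 8) ^ l + exp (- real l)) \<le> exp (l / 2) * \<theta> ^ l * 1"
      using \<theta> by (intro mult_left_mono) auto
    moreover have "G.prob (Bad y) \<le> G.prob {\<omega> \<in> space gauss_space. Z y \<omega> \<le> (7 / 8 * \<theta>)\<^sup>2 * card {..<l}}
        + G.prob {\<omega> \<in> space gauss_space. Z y \<omega> \<ge> K\<^sup>2 * l}"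
      unfolding Bad_def by (rule measure_Un_le) measurable
    ultimately show ?thesis
      using lower upper by (simp only: distrib_left)
  qed
  define S where "S = - (\<Union>y\<in>X. Bad y)"
  have "space (gauss_space :: ('m \<times> 'k \<Rightarrow> real) measure) - (\<Union>y\<in>X. Bad y) \<in> sets gauss_space"
    using X(1) by (intro sets.Diff sets.finite_UN sets.top Bad_sets)
  then have S: "S \<in> sets gauss_space" by (simp add: S_def Compl_eq_Diff_UNIV)
  have "G.prob (- S) \<le> (\<Sum>y\<in>X. G.prob (Bad y))"
    unfolding S_def double_complement using X(1) by (intro measure_UNION_le) auto
  also have "\<dots> \<le> real (card X) * (exp (real l / 2) * \<theta> ^ l)"
    using sum_bounded_above[of X "\<lambda>y. G.prob (Bad y)"] Bad_prob by simp
  also have "\<dots> \<le> (1 + 2 / \<epsilon>) ^ CARD('k) * (exp (real l / 2) * \<theta> ^ l)"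
    using X(4) \<theta> by (intro mult_right_mono) auto
  \<comment> \<open>The factor \<open>\<theta> ^ CARD('k)\<close> is split off to offset the
    \<open>1 / \<epsilon>\<close> in the size of the net.\<close>
  also have "\<theta> ^ l = \<theta> ^ CARD('k) * \<theta> ^ (l - CARD('k))"
    using l by (simp flip: power_add)
  also have "(1 + 2 / \<epsilon>) ^ CARD('k) * (exp (real l / 2) * (\<theta> ^ CARD('k) * \<theta> ^ (l - CARD('k))))
      = exp (real l / 2) * ((1 + 2 / \<epsilon>) * \<theta>) ^ CARD('k) * \<theta> ^ (l - CARD('k))"
    by (simp add: power_mult_distrib mult_ac)
  also have "\<dots> \<le> exp (real l / 2) * (10 + 8 * \<tau>) ^ CARD('k) * \<theta> ^ (l - CARD('k))"
  proof -
    have "(1 + 2 / \<epsilon>) * \<theta> = 3 * \<theta> + 16 / 5 * K"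
      using \<theta> K by (simp add: \<epsilon>_def d_def field_simps)
    also have "\<dots> \<le> 10 + 8 * \<tau>" using \<theta> by (simp add: K_def add_divide_distrib)
    finally have "((1 + 2 / \<epsilon>) * \<theta>) ^ CARD('k) \<le> (10 + 8 * \<tau>) ^ CARD('k)"
      using \<epsilon> \<theta> by (intro power_mono) auto
    then show ?thesis using \<theta> by (intro mult_right_mono mult_left_mono) auto
  qed
  finally have prob: "G.prob (- S) \<le> exp (real l / 2) * (10 + 8 * \<tau>) ^ CARD('k) * \<theta> ^ (l - CARD('k))" .
  have low: "s * \<theta> * sqrt (real l) / 4 * norm x \<le> L2_set (\<lambda>j. W \<omega> j \<bullet> x) {..<l}"
    if \<omega>: "\<omega> \<in> S" for \<omega> x
  proof -
    define f where "f x = L2_set (\<lambda>j. W \<omega> j \<bullet> x) {..<l}" for x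
    have fZ: "f y = s * sqrt (Z y \<omega>)" for y
      using b(2) by (simp add: f_def L2_set_def Z_def power_divide sum_divide_distrib[symmetric]
          real_sqrt_divide)
    have Z: "(7 / 8 * \<theta>)\<^sup>2 * l \<le> Z y \<omega>" "Z y \<omega> \<le> K\<^sup>2 * l" if "y \<in> X" for y
      using that \<omega> by (auto simp: S_def Bad_def)
    have "(s * (7 / 8 * \<theta>) * sqrt l - \<epsilon> * (s * K * sqrt l) / (1 - \<epsilon>)) * norm x \<le> f x"
    proof (rule seminorm_lower_bound_from_net[OF _ _ _ X(2,3) \<epsilon>, where B="\<Sum>j<l. norm (W \<omega> j)"])
      show "f (x + y) \<le> f x + f y" for x y
        unfolding f_def inner_add_right by (rule L2_set_triangle_ineq)
      show "f (c *\<^sub>R x) = \<bar>c\<bar> * f x" for c x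
        by (simp add: f_def L2_set_def power_mult_distrib sum_distrib_left[symmetric] real_sqrt_mult)
      show "f x \<le> (\<Sum>j<l. norm (W \<omega> j)) * norm x" for x
      proof -
        have "f x \<le> (\<Sum>j<l. \<bar>W \<omega> j \<bullet> x\<bar>)" unfolding f_def by (rule L2_set_le_sum_abs)
        also have "\<dots> \<le> (\<Sum>j<l. norm (W \<omega> j) * norm x)"
          by (intro sum_mono Cauchy_Schwarz_ineq2)
        finally show ?thesis by (simp add: sum_distrib_right)
      qed
      show "s * (7 / 8 * \<theta>) * sqrt l \<le> f y" if "y \<in> X" for y
        using real_sqrt_le_mono[OF Z(1)[OF that]] \<theta> b(2)
        by (simp add: fZ real_sqrt_mult mult.assoc)
      show "f y \<le> s * K * sqrt l" if "y \<in> X" for y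
        using real_sqrt_le_mono[OF Z(2)[OF that]] K b(2)
        by (simp add: fZ real_sqrt_mult mult.assoc)
    qed
    also have "\<epsilon> * (s * K * sqrt l) / (1 - \<epsilon>) = s * sqrt l * (\<epsilon> * K / (1 - \<epsilon>))"
      by (simp add: mult_ac)
    finally show ?thesis
      unfolding \<epsilon>K by (simp add: f_def d_def algebra_simps)
  qed
  show thesis
    using that[OF S] prob low by (simp add: \<tau>_def)
qed

text \<open>A chi-square tail at level \<open>16 m\<close> for each row, then a union over the
  \<open>m\<close> rows. Since a row has at most \<open>m\<close> entries, the exponents add up to
  at most \<open>m + m/2 - 4 m\<close>, which is below \<open>- 2 m\<close>.\<close>

lemma gauss_row_norm_bound:
  assumes "CARD('k::finite) \<le> CARD('m::finite)"
  obtains S where "S \<in> sets (gauss_space :: ('m \<times> 'k \<Rightarrow> real) measure)"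
    "measure gauss_space (- S) \<le> exp (- 2 * real CARD('m))"
    "\<And>\<omega> i. \<omega> \<in> S \<Longrightarrow> norm (gauss_mat \<omega> $ i) \<le> 4 * sqrt (real CARD('m))"
proof -
  interpret G: prob_space "gauss_space :: ('m \<times> 'k \<Rightarrow> real) measure"
    by (rule prob_space_gauss_space)
  let ?m = "CARD('m)"
  define Bad where "Bad i = {\<omega> :: 'm \<times> 'k \<Rightarrow> real \<in> space gauss_space. (\<Sum>c\<in>UNIV. (\<omega> (i, c))\<^sup>2) \<ge> 16 * real ?m}" for i
  have Bad_sets [measurable]: "Bad i \<in> sets gauss_space" for i
    unfolding Bad_def by measurable
  have Bad_prob: "G.prob (Bad i) \<le> exp (1/2) ^ ?m * exp (- 4 * real ?m)" for i
  proof -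
    have "G.prob (Bad i) \<le> sqrt 2 ^ card (UNIV :: 'k set) * exp (- (16 * real ?m) / 4)"
      unfolding Bad_def
      by (rule G.chi_square_upper_tail[OF _ indep_vars_gauss_reindex distributed_gauss_component])
         (auto simp: inj_on_def)
    also have "sqrt 2 ^ CARD('k) \<le> exp (1/2 :: real) ^ ?m"
      using order_trans[OF power_mono[OF sqrt2_le_exp_half] power_increasing[OF assms]] by simp
    finally show ?thesis by simp
  qed
  define S where "S = - (\<Union>i\<in>UNIV. Bad i)"
  have "space (gauss_space :: ('m \<times> 'k \<Rightarrow> real) measure) - (\<Union>i\<in>UNIV. Bad i) \<in> sets gauss_space"
    by measurable
  then have S: "S \<in> sets gauss_space" by (simp add: S_def Compl_eq_Diff_UNIV)
  have "G.prob (- S) \<le> (\<Sum>i\<in>UNIV. G.prob (Bad i))"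
    unfolding S_def double_complement by (intro measure_UNION_le) auto
  also have "\<dots> \<le> real ?m * (exp (1/2) ^ ?m * exp (- 4 * real ?m))"
    using sum_bounded_above[of UNIV "\<lambda>i. G.prob (Bad i)"] Bad_prob by simp
  also have "\<dots> \<le> exp (real ?m) * (exp (1/2) ^ ?m * exp (- 4 * real ?m))"
    using order_trans[OF _ exp_ge_add_one_self[of "real ?m"]] by (intro mult_right_mono) auto
  also have "\<dots> \<le> exp (- 2 * real ?m)"
    by (simp flip: exp_add exp_of_nat_mult)
  finally have prob: "G.prob (- S) \<le> exp (- 2 * real ?m)" .
  have "norm (gauss_mat \<omega> $ i) \<le> 4 * sqrt (real ?m)" if "\<omega> \<in> S" for \<omega> i
  proof -
    have "(\<Sum>c\<in>UNIV. (\<omega> (i, c))\<^sup>2) \<le> 16 * real ?m"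
      using that by (auto simp: S_def Bad_def not_le intro: less_imp_le)
    then have "norm (gauss_mat \<omega> $ i) \<le> sqrt (16 * real ?m)"
      by (simp add: norm_vec_def L2_set_def gauss_mat_def)
    then show ?thesis by (simp add: real_sqrt_mult)
  qed
  then show thesis using that[OF S prob] by blast
qed

subsection \<open>Beta duals\<close>

text \<open>For \<open>\<delta> > 0\<close> the letters are symmetric about 0 with spacing
  \<open>2 * \<delta>\<close>, and the closed intervals of radius \<open>\<delta>\<close> around
  them cover exactly the interval from \<open>- L * \<delta>\<close> to \<open>L * \<delta>\<close>.
  Whether 0 is a letter depends on the parity of \<open>L\<close>.\<close>

definition midrise_alphabet :: "nat \<Rightarrow> real \<Rightarrow> real set" where
  "midrise_alphabet L \<delta> = (\<lambda>i. \<delta> * (2 * real i - (real L - 1))) ` {..<L}"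

lemma card_midrise_alphabet: "\<delta> > 0 \<Longrightarrow> card (midrise_alphabet L \<delta>) = L"
  unfolding midrise_alphabet_def by (subst card_image) (auto simp: inj_on_def)

lemma midrise_alphabet_covers:
  assumes \<delta>: "\<delta> > 0" and L: "L > 0" and v: "\<bar>v\<bar> \<le> real L * \<delta>"
  obtains q where "q \<in> midrise_alphabet L \<delta>" "\<bar>v - q\<bar> \<le> \<delta>"
proof -
  define w where "w = (v / \<delta> + real L) / 2"
  have vw: "v = \<delta> * (2 * w - real L)" using \<delta> by (simp add: w_def field_simps)
  have w: "0 \<le> w" "w \<le> real L"
    using v \<delta> by (auto simp: w_def abs_le_iff field_simps)
  \<comment> \<open>The minimum matters at the right end \<open>w = L\<close>, where the floor alone
    would give the index \<open>L\<close>.\<close>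
  define i where "i = min (L - 1) (nat \<lfloor>w\<rfloor>)"
  have i: "i < L" "real i \<le> w" "w \<le> real i + 1"
  proof -
    show "i < L" using L by (simp add: i_def)
    have "real (nat \<lfloor>w\<rfloor>) \<le> w" "w \<le> real (nat \<lfloor>w\<rfloor>) + 1"
      using w(1) by linarith+
    then show "real i \<le> w" "w \<le> real i + 1"
      using w(2) L by (auto simp: i_def min_def)
  qed
  let ?q = "\<delta> * (2 * real i - (real L - 1))"
  have "v - ?q = \<delta> * (2 * (w - real i) - 1)" by (simp add: vw algebra_simps)
  then have "\<bar>v - ?q\<bar> = \<delta> * \<bar>2 * (w - real i) - 1\<bar>" using \<delta> by (simp add: abs_mult)
  also have "\<dots> \<le> \<delta> * 1" using i \<delta> by (intro mult_left_mono) auto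
  finally have "\<bar>v - ?q\<bar> \<le> \<delta>" by simp
  then show thesis using i(1) by (intro that[of ?q]) (auto simp: midrise_alphabet_def)
qed

text \<open>With \<open>u = \<beta> ^ N * (\<Sum>n<N. \<dots>)\<close> this is the greedy noise-shaping recursion
  \<open>u\<^sub>n = \<beta> * u\<^sub>n\<^sub>-\<^sub>1 + y\<^sub>n - q\<^sub>n\<close>; stability means that \<open>\<bar>u\<bar> \<le> \<delta>\<close> is preserved.\<close>

lemma greedy_beta_quantizer:
  fixes y :: "nat \<Rightarrow> real"
  assumes \<delta>: "\<delta> > 0" and L: "L > 0" and \<beta>: "\<beta> > 0"
    and stable: "\<mu> + \<beta> * \<delta> \<le> real L * \<delta>" and y: "\<And>n. n < N \<Longrightarrow> \<bar>y n\<bar> \<le> \<mu>"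
  shows "\<exists>q. (\<forall>n. q n \<in> midrise_alphabet L \<delta>) \<and>
    \<bar>\<Sum>n<N. (1 / \<beta>) ^ Suc n * (y n - q n)\<bar> \<le> \<delta> * (1 / \<beta>) ^ N"
  using y
proof (induction N)
  case 0
  \<comment> \<open>The sum is empty, but \<open>q\<close> must take letters everywhere, so a
    constant letter is supplied.\<close>
  have "\<bar>0\<bar> \<le> real L * \<delta>" using \<delta> by simp
  then obtain a where "a \<in> midrise_alphabet L \<delta>" using midrise_alphabet_covers[OF \<delta> L] by metis
  then show ?case using \<delta> by (intro exI[of _ "\<lambda>_. a"]) simp
next
  case (Suc N)
  then obtain q where q: "\<And>n. q n \<in> midrise_alphabet L \<delta>"
    and le: "\<bar>\<Sum>n<N. (1 / \<beta>) ^ Suc n * (y n - q n)\<bar> \<le> \<delta> * (1 / \<beta>) ^ N"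
    by (metis less_Suc_eq)
  define s where "s = (\<Sum>n<N. (1 / \<beta>) ^ Suc n * (y n - q n))"
  have us: "\<bar>\<beta> ^ N * s\<bar> \<le> \<delta>"
    using le \<beta> unfolding s_def[symmetric] by (simp add: abs_mult field_simps)
  have "\<bar>y N + \<beta> * (\<beta> ^ N * s)\<bar> \<le> \<bar>y N\<bar> + \<beta> * \<bar>\<beta> ^ N * s\<bar>"
    using abs_triangle_ineq[of "y N" "\<beta> * (\<beta> ^ N * s)"] \<beta> by (simp add: abs_mult)
  also have "\<dots> \<le> \<mu> + \<beta> * \<delta>"
    using Suc.prems us \<beta> by (intro add_mono mult_left_mono) auto
  also note stable
  finally obtain a where a: "a \<in> midrise_alphabet L \<delta>" "\<bar>y N + \<beta> * (\<beta> ^ N * s) - a\<bar> \<le> \<delta>"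
    using midrise_alphabet_covers[OF \<delta> L] by metis
  \<comment> \<open>Setting the letter at \<open>N\<close> leaves the earlier terms unchanged, and
    the new sum is a scaled rounding error of the updated state.\<close>
  have "(\<Sum>n<Suc N. (1 / \<beta>) ^ Suc n * (y n - (q(N := a)) n)) = s + (1 / \<beta>) ^ Suc N * (y N - a)"
    by (simp add: s_def)
  also have "\<dots> = (1 / \<beta>) ^ Suc N * (y N + \<beta> * (\<beta> ^ N * s) - a)"
    using \<beta> by (simp add: field_simps)
  also have "\<bar>\<dots>\<bar> = (1 / \<beta>) ^ Suc N * \<bar>y N + \<beta> * (\<beta> ^ N * s) - a\<bar>"
    using \<beta> by (simp add: abs_mult)
  also have "\<dots> \<le> (1 / \<beta>) ^ Suc N * \<delta>"
    using a(2) \<beta> by (intro mult_left_mono) auto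
  finally show ?case
    using q a(1) by (intro exI[of _ "q(N := a)"]) (simp add: mult.commute)
qed

text \<open>The lower bound makes the frame operator injective, and \<open>g\<close> is its inverse.
  Sending \<open>z\<close> to \<open>g (\<Sum>j<l. z j *\<^sub>R W j)\<close> is then the
  pseudo-inverse of the analysis map, of norm at most \<open>1 / c\<close>.\<close>

lemma frame_operator_inverse:
  fixes W :: "nat \<Rightarrow> 'a::euclidean_space"
  assumes c: "c > 0" and low: "\<And>x. c * norm x \<le> L2_set (\<lambda>j. W j \<bullet> x) {..<l}"
  obtains g where "linear g" "\<And>x. g (\<Sum>j<l. (W j \<bullet> x) *\<^sub>R W j) = x"
    "\<And>z. c * norm (g (\<Sum>j<l. z j *\<^sub>R W j)) \<le> L2_set z {..<l}"
proof -
  define T where "T x = (\<Sum>j<l. (W j \<bullet> x) *\<^sub>R W j)" for x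
  have lin: "linear T"
    by (rule linearI) (simp_all add: T_def inner_add_right algebra_simps sum.distrib scaleR_sum_right)
  have quad: "x \<bullet> T x = (L2_set (\<lambda>j. W j \<bullet> x) {..<l})\<^sup>2" for x
    by (simp add: T_def inner_sum_right L2_set_def sum_nonneg power2_eq_square inner_commute)
  have "inj T"
  proof (subst linear_injective_0[OF lin], intro allI impI)
    fix x assume "T x = 0"
    then have "L2_set (\<lambda>j. W j \<bullet> x) {..<l} = 0" using quad[of x] by simp
    then have "c * norm x \<le> 0" using low[of x] by simp
    then show "x = 0" using c by (simp add: mult_le_0_iff)
  qed
  then obtain g where g: "linear g" "\<And>x. g (T x) = x" "\<And>x. T (g x) = x"
    using linear_injective_isomorphism[OF lin] by blast
  have "c * norm (g (\<Sum>j<l. z j *\<^sub>R W j)) \<le> L2_set z {..<l}" for z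
  proof -
    define w where "w = g (\<Sum>j<l. z j *\<^sub>R W j)"
    define r where "r = L2_set (\<lambda>j. W j \<bullet> w) {..<l}"
    \<comment> \<open>The square of \<open>r\<close> is the inner product of \<open>z\<close> with
      the analysis coefficients of \<open>w\<close>. Cauchy-Schwarz bounds it by
      \<open>L2_set z {..<l} * r\<close>, and one factor \<open>r\<close> cancels.\<close>
    have "r * r = w \<bullet> (\<Sum>j<l. z j *\<^sub>R W j)"
      using quad[of w] by (simp add: w_def g(3) r_def power2_eq_square)
    also have "\<dots> = (\<Sum>j<l. z j * (W j \<bullet> w))"
      by (simp add: inner_sum_right inner_commute)
    also have "\<dots> \<le> (\<Sum>j<l. \<bar>z j\<bar> * \<bar>W j \<bullet> w\<bar>)"
      by (intro sum_mono) (simp flip: abs_mult)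
    also have "\<dots> \<le> L2_set z {..<l} * r"
      unfolding r_def by (rule L2_set_mult_ineq)
    finally have "r \<le> L2_set z {..<l}"
      using L2_set_nonneg[of "\<lambda>j. W j \<bullet> w" "{..<l}"] L2_set_nonneg[of z "{..<l}"]
      unfolding r_def[symmetric] by (metis less_le mult_le_cancel_right_pos)
    then show ?thesis using low[of w] by (simp add: w_def r_def)
  qed
  then show thesis using that g(1,2) by (auto simp: T_def)
qed

text \<open>\<open>v q\<close> is \<open>V q\<close>, and \<open>h\<close> applies the
  pseudo-inverse of \<open>V E\<close> to it, so the matrix \<open>F\<close> of \<open>h\<close> is
  a left inverse of \<open>E\<close>. Hence \<open>x - F q = F (E x - q)\<close>, whose norm is at
  most that of \<open>V (E x - q)\<close> divided by \<open>c\<close>. The quantizer bounds the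
  entries of that vector.\<close>

lemma D_aL_le_beta_dual:
  fixes E :: "real ^ 'k ^ 'm" and idx :: "nat \<Rightarrow> nat \<Rightarrow> 'm"
  assumes idx: "inj_on (\<lambda>(j, n). idx j n) ({..<l} \<times> {..<N})"
    and \<delta>: "\<delta> > 0" and L: "L > 0" and \<beta>: "\<beta> > 0" and c: "c > 0"
    and stable: "\<mu> + \<beta> * \<delta> \<le> real L * \<delta>"
    and rows: "\<And>i. norm (E $ i) \<le> \<mu>"
    and low: "\<And>x. c * norm x
      \<le> L2_set (\<lambda>j. (\<Sum>n<N. (1 / \<beta>) ^ Suc n *\<^sub>R E $ idx j n) \<bullet> x) {..<l}"
  shows "D_aL E L \<le> ereal (sqrt (real l) * \<delta> * (1 / \<beta>) ^ N / c)"
proof -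
  define W where "W j = (\<Sum>n<N. (1 / \<beta>) ^ Suc n *\<^sub>R E $ idx j n)" for j
  let ?A = "midrise_alphabet L \<delta>" and ?J = "{..<l} \<times> {..<N}"
  obtain g where g: "linear g" "\<And>x. g (\<Sum>j<l. (W j \<bullet> x) *\<^sub>R W j) = x"
    "\<And>z. c * norm (g (\<Sum>j<l. z j *\<^sub>R W j)) \<le> L2_set z {..<l}"
    using frame_operator_inverse[OF c, of W l] low unfolding W_def by blast
  define v where "v q j = (\<Sum>n<N. (1 / \<beta>) ^ Suc n * q $ idx j n)" for q :: "real ^ 'm" and j
  define h where "h q = g (\<Sum>j<l. v q j *\<^sub>R W j)" for q
  have "linear (\<lambda>q. \<Sum>j<l. v q j *\<^sub>R W j)"
    by (rule linearI)
       (simp_all add: v_def algebra_simps sum.distrib scaleR_sum_right sum_distrib_left)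
  from linear_compose[OF this g(1)] have h: "linear h"
    by (simp add: h_def[abs_def] o_def)
  define F where "F = matrix h"
  have F: "F *v q = h q" for q
    unfolding F_def by (rule matrix_works) (use h in \<open>simp only: linear_matrix_vector_mul_eq\<close>)
  have vE: "v (E *v x) j = W j \<bullet> x" for x j
    by (simp add: v_def W_def inner_sum_left matrix_vector_mul_component)
  have FE: "F *v (E *v x) = x" for x
    unfolding F h_def vE by (rule g(2))
  then have inv: "F ** E = mat 1"
    by (subst matrix_eq) (simp add: matrix_vector_mul_assoc[symmetric])
  have "D_s F ?A (cball 0 1) \<le> ereal (sqrt (real l) * \<delta> * (1 / \<beta>) ^ N / c)"
    unfolding D_s_def
  proof (rule SUP_least)
    fix x :: "real ^ 'k" assume "x \<in> cball 0 1"
    then have x: "norm x \<le> 1" by simp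
    have y: "\<bar>(E *v x) $ i\<bar> \<le> \<mu>" for i
    proof -
      have "\<bar>(E *v x) $ i\<bar> \<le> norm (E $ i) * norm x"
        unfolding matrix_vector_mul_component by (rule Cauchy_Schwarz_ineq2)
      also have "\<dots> \<le> norm (E $ i) * 1" using x by (intro mult_left_mono) auto
      finally show ?thesis using rows[of i] by simp
    qed
    have "\<forall>j. \<exists>q. (\<forall>n. q n \<in> ?A) \<and>
      \<bar>\<Sum>n<N. (1 / \<beta>) ^ Suc n * ((E *v x) $ idx j n - q n)\<bar> \<le> \<delta> * (1 / \<beta>) ^ N"
      by (intro allI greedy_beta_quantizer[OF \<delta> L \<beta> stable] y)
    then obtain Q where Q: "\<And>j n. Q j n \<in> ?A"
      and Qle: "\<And>j. \<bar>\<Sum>n<N. (1 / \<beta>) ^ Suc n * ((E *v x) $ idx j n - Q j n)\<bar> \<le> \<delta> * (1 / \<beta>) ^ N"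
      by metis
    \<comment> \<open>Rows outside the blocks receive some value of \<open>Q\<close>, which is a
      letter because \<open>Q\<close> takes letters everywhere. The map \<open>v\<close> ignores
      these coordinates.\<close>
    define q :: "real ^ 'm" where
      "q = (\<chi> i. case inv_into ?J (\<lambda>(j, n). idx j n) i of (j, n) \<Rightarrow> Q j n)"
    have qA: "q \<in> alph_vecs ?A"
      using Q by (auto simp: alph_vecs_def q_def split: prod.split)
    have qidx: "q $ idx j n = Q j n" if "j < l" "n < N" for j n
      using inv_into_f_f[OF idx, of "(j, n)"] that by (simp add: q_def)
    have z: "\<bar>v (E *v x - q) j\<bar> \<le> \<delta> * (1 / \<beta>) ^ N" if "j < l" for j
      using Qle[of j] that by (simp add: v_def qidx)
    have "x - F *v q = h (E *v x - q)"
      using FE[of x] by (simp add: F[symmetric] matrix_vector_mult_diff_distrib)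
    then have "c * norm (x - F *v q) \<le> L2_set (v (E *v x - q)) {..<l}"
      using g(3)[of "v (E *v x - q)"] by (simp add: h_def)
    also have "\<dots> = L2_set (\<lambda>j. \<bar>v (E *v x - q) j\<bar>) {..<l}"
      by (simp add: L2_set_def)
    also have "\<dots> \<le> L2_set (\<lambda>_. \<delta> * (1 / \<beta>) ^ N) {..<l}"
      using z by (intro L2_set_mono) auto
    also have "\<dots> = sqrt (real l) * \<delta> * (1 / \<beta>) ^ N"
      using \<delta> \<beta> by (simp add: L2_set_constant abs_mult)
    finally have "norm (x - F *v q) \<le> sqrt (real l) * \<delta> * (1 / \<beta>) ^ N / c"
      using c by (simp add: pos_le_divide_eq mult.commute)
    then show "(INF q\<in>alph_vecs ?A. ereal (norm (x - F *v q)))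
        \<le> ereal (sqrt (real l) * \<delta> * (1 / \<beta>) ^ N / c)"
      by (intro INF_lower2[OF qA]) simp
  qed
  then have "D_a E ?A (cball 0 1) \<le> ereal (sqrt (real l) * \<delta> * (1 / \<beta>) ^ N / c)"
    unfolding D_a_def using inv by (intro INF_lower2[of F]) auto
  moreover have "?A \<in> {A. finite A \<and> card A = L}"
    using card_midrise_alphabet[OF \<delta>] by (simp add: midrise_alphabet_def)
  ultimately show ?thesis
    unfolding D_aL_def by (intro INF_lower2[of ?A])
qed

subsection \<open>The error bound\<close>

lemma exists_block_indexing:
  assumes "l * N \<le> CARD('m::finite)"
  obtains idx :: "nat \<Rightarrow> nat \<Rightarrow> 'm::finite" where "inj_on (\<lambda>(j, n). idx j n) ({..<l} \<times> {..<N})"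
proof -
  have "card ({..<l} \<times> {..<N}) \<le> card (UNIV :: 'm set)" using assms by simp
  then obtain f :: "nat \<times> nat \<Rightarrow> 'm" where "inj_on f ({..<l} \<times> {..<N})"
    using card_le_inj[of "{..<l} \<times> {..<N}" "UNIV :: 'm set"] by auto
  then show thesis using that[of "\<lambda>j n. f (j, n)"] by (simp add: case_prod_beta')
qed

text \<open>The radix: \<open>\<beta> = L * M / (M + 1)\<close> maximises \<open>(L - \<beta>) * \<beta> powr M\<close>, and \<open>\<beta> > 1\<close> is exactly the
  condition \<open>M * (L - 1) > 1\<close> on \<open>\<eta>\<close>.\<close>

lemma radix_powr_bounds:
  fixes M L \<beta> a :: real
  assumes M: "M > 0" and L: "L > 0" and a: "a \<ge> 0"
  defines "\<beta> \<equiv> L * M / (M + 1)"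
  shows "\<beta> powr (- a) \<le> exp (a / M) * L powr (- a)"
proof -
  \<comment> \<open>The radix falls short of \<open>L\<close> by the factor
    \<open>1 + 1 / M \<le> exp (1 / M)\<close>. For \<open>a = M\<close> the loss is
    \<open>exp 1\<close>; for \<open>a = \<eta> * N\<close> with \<open>M = (1 - \<eta>) * N\<close>
    it is \<open>exp (\<eta> / (1 - \<eta>))\<close>.\<close>
  have "1 + 1 / M = (M + 1) / M" using M by (simp add: field_simps)
  then have "\<beta> * (1 + 1 / M) = L" using M by (simp add: \<beta>_def)
  moreover have \<beta>: "\<beta> > 0" using M L by (simp add: \<beta>_def)
  ultimately have "L powr a = \<beta> powr a * (1 + 1 / M) powr a"
    using M by (metis powr_mult)
  also have "(1 + 1 / M) powr a \<le> exp (1 / M) powr a"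
    using M a exp_ge_add_one_self[of "1 / M"] by (intro powr_mono2) auto
  also have "\<dots> = exp (a / M)" by (simp add: powr_def)
  finally have "L powr a \<le> \<beta> powr a * exp (a / M)" by (simp add: mult_left_mono)
  then show ?thesis using \<beta> L by (simp add: powr_minus field_simps)
qed

theorem theorem4:
  fixes m l k L :: nat and \<eta> :: real
  assumes "m = CARD('m::finite)" and "k = CARD('k::finite)"
    and "m \<ge> l" and "l > k" and "L \<ge> 2"
    and "m < 2 * l \<longrightarrow> L > 2"
    and "0 < \<eta>" and "\<eta> < 1 - 1 / (real (m div l) * (real L - 1))"
  shows "\<exists>S \<in> sets (gauss_space :: ('m \<times> 'k \<Rightarrow> real) measure).
     S \<subseteq> {\<omega> \<in> space gauss_space.
            D_aL (gauss_mat \<omega>) L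
              < ereal (16 * exp 1 * real m powr (3/2) / real l
                       * real L powr (- (1 - \<eta>) * real (m div l)))}
   \<and> measure gauss_space S \<ge>
       1 - exp (real l / 2)
           * (10 + 8 * sqrt (\<eta> * real (m div l) * ln (real L))) ^ k
           * exp (\<eta> / (1 - \<eta>) * (real l - real k))
           * real L powr (- \<eta> * real (m div l) * (real l - real k))
         - exp (- 2 * real m)"
proof -
  interpret G: prob_space "gauss_space :: ('m \<times> 'k \<Rightarrow> real) measure"
    by (rule prob_space_gauss_space)

  \<comment> \<open>Choice of parameters\<close>
  define N where "N = m div l"
  define M where "M = (1 - \<eta>) * real N"
  define \<beta> where "\<beta> = real L * M / (M + 1)"
  \<comment> \<open>The exponent \<open>N\<close> is shared out: the part \<open>\<eta> * N\<close>
    pays for a singular value as small as order \<open>\<theta>\<close>, and \<open>M\<close>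
    remains for the error.\<close>
  define \<theta> where "\<theta> = \<beta> powr (- (\<eta> * real N))"
  define \<mu> where "\<mu> = 4 * sqrt (real m)"
  define \<delta> where "\<delta> = \<mu> / (real L - \<beta>)"
  have l0: "l > 0" "m > 0" using assms by auto
  have N: "N \<ge> 1" "l * N \<le> m"
    using assms(3) l0 by (auto simp: N_def Suc_le_eq div_greater_zero_iff)
  have "1 / (real N * (real L - 1)) > 0" using N assms(5) by simp
  then have \<eta>: "0 < \<eta>" "\<eta> < 1" using assms(7,8) unfolding N_def by linarith+
  have M0: "M > 0" using \<eta> N by (simp add: M_def)
  have MN: "M < real N" using \<eta> N by (simp add: M_def)
  have M1: "M * (real L - 1) > 1"
  proof -
    have "1 / (real N * (real L - 1)) < 1 - \<eta>" using assms(8) by (simp add: N_def)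
    then show ?thesis using N assms(5) by (simp add: M_def pos_divide_less_eq mult_ac)
  qed
  have \<beta>1: "\<beta> > 1" using M1 M0 by (simp add: \<beta>_def field_simps)
  have L\<beta>: "real L - \<beta> = real L / (M + 1)" using M0 by (simp add: \<beta>_def field_simps)
  have \<beta>L: "\<beta> < real L"
  proof -
    have "real L / (M + 1) > 0" using M0 assms(5) by simp
    then show ?thesis using L\<beta> by simp
  qed
  have \<mu>0: "\<mu> > 0" using l0 by (simp add: \<mu>_def)
  have \<delta>: "\<delta> > 0" "\<mu> + \<beta> * \<delta> = real L * \<delta>"
    using \<mu>0 \<beta>L by (auto simp: \<delta>_def field_simps)
  have "\<eta> * real N > 0" using \<eta> N by simp
  then have \<theta>: "0 < \<theta>" "\<theta> \<le> 1"
    using \<beta>1 by (auto simp: \<theta>_def powr_le1 powr_minus field_simps ge_one_powr_ge_zero)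

  \<comment> \<open>Good events for the singular value and the row norms\<close>
  obtain idx :: "nat \<Rightarrow> nat \<Rightarrow> 'm" where idx: "inj_on (\<lambda>(j, n). idx j n) ({..<l} \<times> {..<N})"
    using exists_block_indexing N(2) assms(1) by metis
  define s where "s = sqrt (\<Sum>n<N. ((1 / \<beta>) ^ Suc n)\<^sup>2)"
  have s: "(\<Sum>n<N. ((1 / \<beta>) ^ Suc n)\<^sup>2) = s\<^sup>2" by (simp add: s_def sum_nonneg)
  \<comment> \<open>The first term of the geometric sum alone gives
    \<open>s \<ge> 1 / \<beta>\<close>, at the cost of one factor \<open>\<beta>\<close> in the
    error.\<close>
  have "((1 / \<beta>) ^ Suc 0)\<^sup>2 \<le> (\<Sum>n<N. ((1 / \<beta>) ^ Suc n)\<^sup>2)"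
    using N by (intro member_le_sum) auto
  then have s1: "1 / \<beta> \<le> s"
    unfolding s_def by (intro real_le_rsqrt) simp
  then have s0: "s > 0" using \<beta>1 by (smt (verit) divide_pos_pos)
  have lk: "l > CARD('k)" using assms by simp
  obtain S1 where S1: "S1 \<in> sets (gauss_space :: ('m \<times> 'k \<Rightarrow> real) measure)"
    "G.prob (- S1) \<le> exp (real l / 2) * (10 + 8 * sqrt (ln (1 / \<theta>))) ^ CARD('k) * \<theta> ^ (l - CARD('k))"
    "\<And>\<omega> x. \<omega> \<in> S1 \<Longrightarrow> s * \<theta> * sqrt (real l) / 4 * norm x
       \<le> L2_set (\<lambda>j. (\<Sum>n<N. (1 / \<beta>) ^ Suc n *\<^sub>R gauss_mat \<omega> $ idx j n) \<bullet> x) {..<l}"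
    using block_singular_value_bound[OF idx lk s s0 \<theta>] that by blast
  have km: "CARD('k) \<le> CARD('m)" using assms by simp
  obtain S2 where S2: "S2 \<in> sets (gauss_space :: ('m \<times> 'k \<Rightarrow> real) measure)"
    "G.prob (- S2) \<le> exp (- 2 * real m)"
    "\<And>\<omega> i. \<omega> \<in> S2 \<Longrightarrow> norm (gauss_mat \<omega> $ i) \<le> \<mu>"
    using gauss_row_norm_bound[OF km, folded assms(1), folded \<mu>_def] that by blast

  \<comment> \<open>Error on the good events\<close>
  have error: "D_aL (gauss_mat \<omega>) L < ereal (16 * exp 1 * real m powr (3/2) / real l
      * real L powr (- (1 - \<eta>) * real N))" if \<omega>: "\<omega> \<in> S1 \<inter> S2" for \<omega>
  proof -
    let ?c = "s * \<theta> * sqrt (real l) / 4"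
    have "D_aL (gauss_mat \<omega>) L \<le> ereal (sqrt (real l) * \<delta> * (1 / \<beta>) ^ N / ?c)"
      using \<omega> \<delta> \<beta>1 s0 \<theta> l0 assms(5) S1(3) S2(3) by (intro D_aL_le_beta_dual[OF idx]) auto
    also have "sqrt (real l) * \<delta> * (1 / \<beta>) ^ N / ?c = 4 * \<delta> * (1 / s) * ((1 / \<beta>) ^ N / \<theta>)"
      using l0 s0 \<theta> by (simp add: field_simps)
    also have "(1 / \<beta>) ^ N / \<theta> = \<beta> powr (- M)"
    proof -
      have "(1 / \<beta>) ^ N = \<beta> powr (- real N)"
        using \<beta>1 by (simp add: powr_minus powr_realpow power_one_over inverse_eq_divide)
      then show ?thesis
        using \<beta>1 by (simp add: \<theta>_def powr_diff[symmetric] M_def algebra_simps)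
    qed
    finally have D: "D_aL (gauss_mat \<omega>) L \<le> ereal (4 * \<delta> * (1 / s) * \<beta> powr (- M))" .
    \<comment> \<open>As \<open>\<delta> = \<mu> * (M + 1) / L\<close>, the factor
      \<open>\<beta>\<close> lost through \<open>s\<close> combines with \<open>\<delta>\<close>
      into \<open>\<mu> * M\<close>.\<close>
    have "M + 1 \<noteq> 0" "real L \<noteq> 0" using M0 assms(5) by auto
    then have \<delta>\<beta>: "\<delta> * \<beta> = \<mu> * M"
      unfolding \<delta>_def L\<beta> by (simp add: \<beta>_def)
    have "4 * \<delta> * (1 / s) * \<beta> powr (- M) \<le> 4 * \<delta> * \<beta> * (exp (M / M) * real L powr (- M))"
    proof (intro mult_mono)
      show "1 / s \<le> \<beta>" using s1 s0 \<beta>1 by (simp add: field_simps)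
      show "\<beta> powr (- M) \<le> exp (M / M) * real L powr (- M)"
        unfolding \<beta>_def using M0 assms(5) by (intro radix_powr_bounds) auto
    qed (use \<delta> s0 \<beta>1 in auto)
    also have "\<dots> = (16 * exp 1 * sqrt (real m) * real L powr (- M)) * M"
      using M0 \<delta>\<beta> by (simp add: \<mu>_def mult_ac)
    \<comment> \<open>The strict inequality comes from \<open>M < N \<le> m / l\<close>, that is,
      from \<open>\<eta> > 0\<close>.\<close>
    also have "\<dots> < (16 * exp 1 * sqrt (real m) * real L powr (- M)) * (real m / real l)"
    proof (rule mult_strict_left_mono)
      have "real l * real N \<le> real m" using N(2) by (simp flip: of_nat_mult)
      then have "real N \<le> real m / real l" using l0 by (simp add: field_simps)
      then show "M < real m / real l" using MN by simp
    qed (use l0 assms(5) in auto)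
    also have "\<dots> = 16 * exp 1 * (real m * sqrt (real m)) / real l * real L powr (- M)"
      by (simp add: field_simps)
    also have "real m * sqrt (real m) = real m powr (3/2)"
    proof -
      have "real m powr (3/2) = real m powr (1 + 1/2)" by simp
      also have "\<dots> = real m powr 1 * real m powr (1/2)" by (rule powr_add)
      finally show ?thesis by (simp add: powr_half_sqrt)
    qed
    finally have "4 * \<delta> * (1 / s) * \<beta> powr (- M)
      < 16 * exp 1 * real m powr (3/2) / real l * real L powr (- (1 - \<eta>) * real N)"
      unfolding M_def mult_minus_left .
    then show ?thesis using D by (meson ereal_less(2) le_less_trans less_ereal.simps(1))
  qed

  \<comment> \<open>Probability of the good events\<close>
  have "\<theta> ^ (l - k) \<le> exp (\<eta> / (1 - \<eta>) * (real l - real k)) * real L powr (- \<eta> * real N * (real l - real k))"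
  proof -
    have "\<theta> \<le> exp (\<eta> * real N / M) * real L powr (- (\<eta> * real N))"
      unfolding \<theta>_def \<beta>_def using M0 \<eta> assms(5) by (intro radix_powr_bounds) auto
    also have "\<eta> * real N / M = \<eta> / (1 - \<eta>)" using N by (simp add: M_def)
    finally have "\<theta> ^ (l - k) \<le> (exp (\<eta> / (1 - \<eta>)) * real L powr (- (\<eta> * real N))) ^ (l - k)"
      using \<theta> by (intro power_mono) auto
    also have "\<dots> = exp (\<eta> / (1 - \<eta>) * (real l - real k)) * real L powr (- \<eta> * real N * (real l - real k))"
      using assms(4,5) by (simp add: power_mult_distrib exp_of_nat2_mult[symmetric] of_nat_diff
          powr_realpow[symmetric] powr_powr)
    finally show ?thesis .
  qed
  moreover have "(10 + 8 * sqrt (ln (1 / \<theta>))) ^ k \<le> (10 + 8 * sqrt (\<eta> * real N * ln (real L))) ^ k"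
  proof -
    have "ln (1 / \<theta>) = \<eta> * real N * ln \<beta>" using \<beta>1 by (simp add: \<theta>_def ln_div ln_powr)
    also have "\<dots> \<le> \<eta> * real N * ln (real L)"
      using \<beta>1 \<beta>L \<eta> by (intro mult_left_mono) auto
    finally show ?thesis using \<theta> by (intro power_mono) auto
  qed
  ultimately have "exp (real l / 2) * (10 + 8 * sqrt (ln (1 / \<theta>))) ^ k * \<theta> ^ (l - k)
    \<le> exp (real l / 2) * (10 + 8 * sqrt (\<eta> * real N * ln (real L))) ^ k
      * (exp (\<eta> / (1 - \<eta>) * (real l - real k)) * real L powr (- \<eta> * real N * (real l - real k)))"
    using \<theta> \<eta> assms(5) by (intro mult_mono) auto
  then have p1: "G.prob (- S1) \<le> exp (real l / 2) * (10 + 8 * sqrt (\<eta> * real N * ln (real L))) ^ k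
      * exp (\<eta> / (1 - \<eta>) * (real l - real k)) * real L powr (- \<eta> * real N * (real l - real k))"
    unfolding mult.assoc by (rule order_trans[OF S1(2)[folded assms(2), unfolded mult.assoc]])
  have compl: "- S = space gauss_space - S" for S :: "('m \<times> 'k \<Rightarrow> real) set"
    by auto
  have "G.prob (- (S1 \<inter> S2)) \<le> G.prob (- S1) + G.prob (- S2)"
    unfolding Compl_Int using S1(1) S2(1) by (intro measure_Un_le) (simp_all only: compl sets.compl_sets)
  moreover have "G.prob (- (S1 \<inter> S2)) = 1 - G.prob (S1 \<inter> S2)"
    unfolding compl using S1(1) S2(1) by (intro G.prob_compl) auto
  ultimately have "G.prob (S1 \<inter> S2) \<ge> 1 - exp (real l / 2) * (10 + 8 * sqrt (\<eta> * real N * ln (real L))) ^ k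
      * exp (\<eta> / (1 - \<eta>) * (real l - real k)) * real L powr (- \<eta> * real N * (real l - real k))
      - exp (- 2 * real m)"
    using p1 S2(2) by linarith
  \<comment> \<open>The witness is a measurable set inside the event, so the measurability of
    \<open>D_aL\<close> does not have to be settled.\<close>
  then show ?thesis
    using error S1(1) S2(1) unfolding N_def by (intro bexI[of _ "S1 \<inter> S2"]) auto
qed

end
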